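(* (Soundness for partial simulation.) Let $\mathbb{B}$ be a set of base cases, and let $B$ and $G$ be sets of partial simulation formulae. If $G, B \vdash^0 G$ (in the proof system for partial simulation) and $\llbracket B \rrbracket \subseteq \mathbb{B}$, then for any formula $(P \preceq Q \text{ if } \phi) \in G$ we have $\mathbb{B} \models P \preceq Q \text{ if } \phi$.
   Context: **Signature and model.** $\Sigma=(S,\le,F)$ is an order-sorted signature. Its sorts split as $S=S^b\sqcup S^c$ (builtin and constructor sorts; builtin sorts have no subsorts), and its symbols as $F=F^b\sqcup F^c\sqcup F^a$ (builtin, constructor, axiomatized). Builtin symbols have only builtin argument and result sorts; constructor symbols never have a builtin result sort. There is a builtin sort $Bool$. The builtin subsignature $\Sigma^b=(S^b,F^b)$ has a fixed model $M^b$ in which each carrier $M^b_s$ is exactly the set of builtin constants of sort $s$, $M^b_{Bool}=\{\mathrm{true},\mathrm{false}\}$, and boolean connectives are standard. The fixed model $M$ of $\Sigma$ has as carrier the ground terms built from builtin constants and constructor symbols. Builtin symbols are interpreted as in $M^b$, constructors freely, and each axiomatized symbol $f\in F^a$ by sending $(m_1,\dots,m_n)$ to the normal form of $f(m_1,\dots,m_n)$ under a fixed constrained rewrite system $R^a$. The system $R^a$ rewrites ground $\Sigma$-terms (with builtin symbols evaluated when applied to builtin constants), is convergent, and has all its normal forms in the carrier of $M$. $X$ is an $S$-sorted set of variables; a valuation is a sort-preserving map $\rho:X\to M$, extended to terms. Constraints are first-order formulae with equality over $\Sigma$, interpreted in $M$ and identified up to equivalence in $M$; builtin constraints are those over $\Sigma^b$.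 $\rho\models\phi$ means that $\phi$ holds in $M$ under $\rho$, and $\models\phi$ means that it holds under all valuations. **Rewrite systems.** A logically constrained rewrite rule is $l\to r \text{ if } \phi$ with $l,r$ terms of the same sort and $\phi$ a constraint; a logically constrained term rewriting system (LCTRS) is a set of such rules. $R_L$ and $R_R$ are two top-most LCTRSs (all rewriting takes place at the root), giving the semantics of a left and a right language with sorts of configurations $Cfg_L$ and $Cfg_R$. They induce the transition relations $\to_L$, $\to_R$ on the elements of $M$ of sort $Cfg_L$, $Cfg_R$ (ground configurations): $\{(\rho(l),\rho(r)) \mid (l\to r\text{ if }\phi)\in R_L,\ \rho\models\phi\}$, and similarly for $R_R$. The rules of $R^a$ and the rules of $R_L$, $R_R$ are assumed to be coherent in the generalized sense of Meseguer (informally: rewriting with $R_L$, $R_R$ is compatible with first normalizing by $R^a$). A path $\gamma\to^*\gamma'$ is complete if no further step is possible from $\gamma'$; such a $\gamma'$ is called terminal. A set of base cases $\mathbb{B}$ is a set of pairs (left, right) of terminal ground configurations. **Partial simulation.** A partial simulation formula is $P\preceq Q\text{ if }\phi$ with $P$ a term of sort $Cfg_L$, $Q$ a term of sort $Cfg_R$ (both possibly with variables), and $\phi$ a constraint. $\mathbb{B}\models P\preceq Q\text{ if }\phi$ means: for every valuation $\rho$ with $\rho\models\phi$ and every complete path $\rho(P)\to_L^*\mathsf{P}'$, either there is a complete path $\rho(Q)\to_R^*\mathsf{Q}'$ with $(\mathsf{P}',\mathsf{Q}')\in\mathbb{B}$, or there is an infinite path $\rho(Q)\to_R\cdots$. For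 a set $R$ of formulae, $\llbracket R\rrbracket=\{(\rho(P),\rho(Q))\mid (P\preceq Q\text{ if }\phi)\in R,\ \rho\models\phi\}$. **Unification modulo axiomatized symbols.** For terms $t_1,t_2$, $\mathit{umas}(t_1,t_2)$ denotes a complete set of unifiers modulo axiomatized symbols, i.e. a set of pairs $(\phi,\sigma)$ of a builtin constraint $\phi$ and a substitution $\sigma$ such that: (soundness) for every $(\phi,\sigma)$ in the set, $\rho(\sigma(t_1))=\rho(\sigma(t_2))$ for every valuation $\rho$ with $\rho\models\phi$; (completeness) for every valuation $\rho$ with $\rho(t_1)=\rho(t_2)$ there are $(\phi,\sigma)$ in the set and a valuation $\rho'$ with $\rho=\rho'\circ\sigma$ and $\rho'\models\phi$. **Derivatives.** For a constrained term $t\text{ if }\phi$ and a rule $l\to r\text{ if }\phi_{lr}$ (variables taken disjoint), $\Delta_{l,r,\phi_{lr}}(t\text{ if }\phi)=\{\sigma'(r)\text{ if }(\phi\wedge\phi'\wedge\phi_{lr}) \mid (\phi',\sigma')\in\mathit{umas}(t,l),\ \phi\wedge\phi'\wedge\phi_{lr}\text{ satisfiable}\}$. $\Delta_R$ is the union of these sets over all rules of $R$. $\Delta_R^{\ge a,\le k}(Q)$ is the set of constrained terms obtained from $Q\text{ if }\top$ by applying $\Delta_R$ at least $a$ and at most $k$ times, for a natural number $k$; $\Delta_R^{\le k}=\Delta_R^{\ge 0,\le k}$. **Proof system.** Sequents have the form $G,B\vdash^g P\preceq Q\text{ if }\phi$ with $g\in\{0,1\}$. For a set $R$ of formulae (variables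 taken disjoint from those of $P,Q$), $\mathit{sub}((P,Q),R)$ is $\bigvee_{(P'\preceq Q'\text{ if }\phi')\in R}\exists\, \mathrm{var}(P',Q',\phi').\,(\phi'\wedge P=P'\wedge Q=Q')$. The rules are: - Axiom: derive $G,B\vdash^g P\preceq Q\text{ if }\bot$. - Base: from $G,B\vdash^g P\preceq Q\text{ if }\phi\wedge\neg\phi_B$ derive $G,B\vdash^g P\preceq Q\text{ if }\phi$, provided $\models\phi_B\rightarrow\bigvee_{(Q'\text{ if }\phi')\in\Delta_{R_R}^{\le k}(Q)}\bigl(\phi'\rightarrow\mathit{sub}((P,Q'),B)\bigr)$. - Circ: from $G,B\vdash^g P\preceq Q\text{ if }\phi\wedge\neg\phi_G$ derive $G,B\vdash^g P\preceq Q\text{ if }\phi$, provided $\models\phi_G\rightarrow\bigvee_{(Q'\text{ if }\phi')\in\Delta_{R_R}^{\ge 1-g,\le k}(Q)}\bigl(\phi'\rightarrow\mathit{sub}((P,Q'),G)\bigr)$. - Step: if $\Delta_{R_L}(P\text{ if }\phi)=\{P^i\text{ if }\phi^i\mid 1\le i\le n\}$, then from $G,B\vdash^1 P^i\preceq Q\text{ if }\phi^i$ for all $1\le i\le n$, and $G,B\vdash^g P\preceq Q\text{ if }\phi\wedge\neg\phi^1\wedge\dots\wedge\neg\phi^n$, derive $G,B\vdash^g P\preceq Q\text{ if }\phi$. $G,B\vdash^g G'$ means that $G,B\vdash^g P\preceq Q\text{ if }\phi$ is derivable for every $(P\preceq Q\text{ if }\phi)\in G'$.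
   Formalization: As printed the system is unsound. In Base and Circ, φ'→sub becomes ∃ fresh variables (φ'∧sub); a derivative's constraint uses σ'(φ_lr) and adds x=σ'(x) for x in var(t); unifiers (φ,σ) in umas must have σ idempotent and φ only over variables fixed by σ. *)

theory Defs
  imports Main "HOL-Library.Infinite_Typeclass"
begin

datatype ('f, 'x) trm = Var (the_var: 'x) | Fun 'f "('f, 'x) trm list"

datatype ('f, 'x) fm =
    Bot
  | Eq "('f, 'x) trm" "('f, 'x) trm"
  | Neg "('f, 'x) fm"
  | Conj "('f, 'x) fm" "('f, 'x) fm"
  | Ex 'x "('f, 'x) fm"

abbreviation Top :: "('f, 'x) fm" where
  "Top \<equiv> Neg Bot"

definition conjs :: "('f, 'x) fm list \<Rightarrow> ('f, 'x) fm" where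
  "conjs \<phi>s = foldr Conj \<phi>s Top"

(* A variable carries its sort, so X has infinitely many variables of each sort. *)
type_synonym ('v, 's) var = "'v \<times> 's"
type_synonym ('f, 'v, 's) tm = "('f, ('v, 's) var) trm"
type_synonym ('f, 'v, 's) constr = "('f, ('v, 's) var) fm"
type_synonym ('f, 'v, 's) sub = "('v, 's) var \<Rightarrow> ('f, 'v, 's) tm"
type_synonym ('f, 's) decl = "'f \<times> 's list \<times> 's"
type_synonym ('f, 'v, 's) ctm = "('f, 'v, 's) tm \<times> ('f, 'v, 's) constr"
type_synonym ('f, 'v, 's) rule = "('f, 'v, 's) tm \<times> ('f, 'v, 's) tm \<times> ('f, 'v, 's) constr"
type_synonym ('f, 'v, 's) psf = "('f, 'v, 's) tm \<times> ('f, 'v, 's) tm \<times> ('f, 'v, 's) constr"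
type_synonym ('f, 'v, 's) umas_fun =
  "('f, 'v, 's) tm \<Rightarrow> ('f, 'v, 's) tm \<Rightarrow> (('f, 'v, 's) constr \<times> ('f, 'v, 's) sub) set"


section \<open>Terms, formulae and substitutions\<close>

primrec vars :: "('f, 'x) trm \<Rightarrow> 'x set" where
  "vars (Var x) = {x}"
| "vars (Fun f ts) = \<Union> (set (map vars ts))"

primrec vars_list :: "('f, 'x) trm \<Rightarrow> 'x list" where
  "vars_list (Var x) = [x]"
| "vars_list (Fun f ts) = concat (map vars_list ts)"

primrec fv :: "('f, 'x) fm \<Rightarrow> 'x set" where
  "fv Bot = {}"
| "fv (Eq t u) = vars t \<union> vars u"
| "fv (Neg \<phi>) = fv \<phi>"
| "fv (Conj \<phi> \<psi>) = fv \<phi> \<union> fv \<psi>"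
| "fv (Ex x \<phi>) = fv \<phi> - {x}"

primrec tsubst :: "('x \<Rightarrow> ('f, 'x) trm) \<Rightarrow> ('f, 'x) trm \<Rightarrow> ('f, 'x) trm" where
  "tsubst \<sigma> (Var x) = \<sigma> x"
| "tsubst \<sigma> (Fun f ts) = Fun f (map (tsubst \<sigma>) ts)"

(* Capture-avoiding; the bound variable is replaced by a fresh one of the same sort. *)
primrec fsubst :: "('f, 'v, 's) constr \<Rightarrow> ('f, 'v, 's) sub \<Rightarrow> ('f, 'v, 's) constr" where
  "fsubst Bot \<sigma> = Bot"
| "fsubst (Eq t u) \<sigma> = Eq (tsubst \<sigma> t) (tsubst \<sigma> u)"
| "fsubst (Neg \<phi>) \<sigma> = Neg (fsubst \<phi> \<sigma>)"
| "fsubst (Conj \<phi> \<psi>) \<sigma> = Conj (fsubst \<phi> \<sigma>) (fsubst \<psi> \<sigma>)"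
| "fsubst (Ex x \<phi>) \<sigma> =
    (let y = (SOME y. snd y = snd x \<and> y \<notin> (\<Union>z \<in> fv \<phi> - {x}. vars (\<sigma> z)))
     in Ex y (fsubst \<phi> (\<sigma>(x := Var y))))"

definition rule_vars :: "('f, 'v, 's) rule \<Rightarrow> ('v, 's) var set" where
  "rule_vars = (\<lambda>(l, r, \<phi>). vars l \<union> vars r \<union> fv \<phi>)"

definition rename_rule ::
  "(('v, 's) var \<Rightarrow> ('v, 's) var) \<Rightarrow> ('f, 'v, 's) rule \<Rightarrow> ('f, 'v, 's) rule" where
  "rename_rule \<pi> = (\<lambda>(l, r, \<phi>). (map_trm id \<pi> l, map_trm id \<pi> r, map_fm id \<pi> \<phi>))"

definition is_variant ::
  "('v, 's) var set \<Rightarrow> ('f, 'v, 's) rule \<Rightarrow> ('f, 'v, 's) rule \<Rightarrow> bool" where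
  "is_variant W \<rho> \<rho>' \<longleftrightarrow>
    (\<exists>\<pi>. bij \<pi> \<and> (\<forall>x. snd (\<pi> x) = snd x) \<and> \<rho>' = rename_rule \<pi> \<rho> \<and> rule_vars \<rho>' \<inter> W = {})"

(* Implements the convention that the variables of a rule are disjoint from those in play (W). *)
definition apart :: "('v, 's) var set \<Rightarrow> ('f, 'v, 's) rule \<Rightarrow> ('f, 'v, 's) rule" where
  "apart W \<rho> = (SOME \<rho>'. is_variant W \<rho> \<rho>')"


section \<open>Signatures and models\<close>

(* All elements of the type 's are sorts; the constructor sorts are those outside bsorts. *)
record ('f, 'v, 's) setting =
  sle :: "'s \<Rightarrow> 's \<Rightarrow> bool"
  bsorts :: "'s set"
  Fb :: "('f, 's) decl set"
  Fc :: "('f, 's) decl set"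
  Fa :: "('f, 's) decl set"
  bool_sort :: 's
  true_sym :: 'f
  false_sym :: 'f
  not_sym :: 'f
  and_sym :: 'f
  or_sym :: 'f
  interp :: "'f \<Rightarrow> ('f, 'v, 's) tm list \<Rightarrow> ('f, 'v, 's) tm"
  Ra :: "('f, 'v, 's) rule set"

type_synonym ('f, 'v, 's) model = "('f, 'v, 's) setting"

definition Fall :: "('f, 'v, 's) model \<Rightarrow> ('f, 's) decl set" where
  "Fall M = Fb M \<union> Fc M \<union> Fa M"

definition bconsts :: "('f, 'v, 's) model \<Rightarrow> ('f, 's) decl set" where
  "bconsts M = {(c, ss, s) \<in> Fb M. ss = []}"

inductive has_sort ::
  "('s \<Rightarrow> 's \<Rightarrow> bool) \<Rightarrow> ('f, 's) decl set \<Rightarrow> ('f, 'v, 's) tm \<Rightarrow> 's \<Rightarrow> bool"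
  for le :: "'s \<Rightarrow> 's \<Rightarrow> bool" and D :: "('f, 's) decl set" where
  var: "has_sort le D (Var x) (snd x)"
| app: "(f, ss, s) \<in> D \<Longrightarrow> list_all2 (has_sort le D) ts ss \<Longrightarrow> has_sort le D (Fun f ts) s"
| subsort: "has_sort le D t s \<Longrightarrow> le s s' \<Longrightarrow> has_sort le D t s'"

definition term_of_sort :: "('f, 'v, 's) model \<Rightarrow> 's \<Rightarrow> ('f, 'v, 's) tm \<Rightarrow> bool" where
  "term_of_sort M s t \<longleftrightarrow> has_sort (sle M) (Fall M) t s"

definition ground_of_sort :: "('f, 'v, 's) model \<Rightarrow> 's \<Rightarrow> ('f, 'v, 's) tm \<Rightarrow> bool" where
  "ground_of_sort M s t \<longleftrightarrow> vars t = {} \<and> term_of_sort M s t"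

definition carrier :: "('f, 'v, 's) model \<Rightarrow> 's \<Rightarrow> ('f, 'v, 's) tm set" where
  "carrier M s = {t. vars t = {} \<and> has_sort (sle M) (bconsts M \<union> Fc M) t s}"

abbreviation carriers :: "('f, 'v, 's) model \<Rightarrow> ('f, 'v, 's) tm list \<Rightarrow> 's list \<Rightarrow> bool" where
  "carriers M ms ss \<equiv> list_all2 (\<lambda>m s. m \<in> carrier M s) ms ss"

primrec wf_fm :: "('s \<Rightarrow> 's \<Rightarrow> bool) \<Rightarrow> ('f, 's) decl set \<Rightarrow> 's set \<Rightarrow> ('f, 'v, 's) constr \<Rightarrow> bool" where
  "wf_fm le D S Bot = True"
| "wf_fm le D S (Eq t u) = (\<exists>s \<in> S. has_sort le D t s \<and> has_sort le D u s)"
| "wf_fm le D S (Neg \<phi>) = wf_fm le D S \<phi>"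
| "wf_fm le D S (Conj \<phi> \<psi>) = (wf_fm le D S \<phi> \<and> wf_fm le D S \<psi>)"
| "wf_fm le D S (Ex x \<phi>) = (snd x \<in> S \<and> wf_fm le D S \<phi>)"

definition wf_constr :: "('f, 'v, 's) model \<Rightarrow> ('f, 'v, 's) constr \<Rightarrow> bool" where
  "wf_constr M = wf_fm (sle M) (Fall M) UNIV"

definition builtin_constr :: "('f, 'v, 's) model \<Rightarrow> ('f, 'v, 's) constr \<Rightarrow> bool" where
  "builtin_constr M = wf_fm (sle M) (Fb M) (bsorts M)"

definition wf_rule :: "('f, 'v, 's) model \<Rightarrow> 's \<Rightarrow> ('f, 'v, 's) rule \<Rightarrow> bool" where
  "wf_rule M s = (\<lambda>(l, r, \<phi>). term_of_sort M s l \<and> term_of_sort M s r \<and> wf_constr M \<phi>)"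

definition wf_subst :: "('f, 'v, 's) model \<Rightarrow> ('f, 'v, 's) sub \<Rightarrow> bool" where
  "wf_subst M \<sigma> \<longleftrightarrow> (\<forall>x. term_of_sort M (snd x) (\<sigma> x))"

definition ground_subst :: "('f, 'v, 's) model \<Rightarrow> ('f, 'v, 's) sub \<Rightarrow> bool" where
  "ground_subst M \<gamma> \<longleftrightarrow> (\<forall>x. ground_of_sort M (snd x) (\<gamma> x))"

definition valuation :: "('f, 'v, 's) model \<Rightarrow> ('f, 'v, 's) sub \<Rightarrow> bool" where
  "valuation M \<rho> \<longleftrightarrow> (\<forall>x. \<rho> x \<in> carrier M (snd x))"

primrec eval :: "('f, 'v, 's) model \<Rightarrow> ('f, 'v, 's) sub \<Rightarrow> ('f, 'v, 's) tm \<Rightarrow> ('f, 'v, 's) tm" where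
  "eval M \<rho> (Var x) = \<rho> x"
| "eval M \<rho> (Fun f ts) = interp M f (map (eval M \<rho>) ts)"

primrec sat :: "('f, 'v, 's) model \<Rightarrow> ('f, 'v, 's) constr \<Rightarrow> ('f, 'v, 's) sub \<Rightarrow> bool" where
  "sat M Bot \<rho> = False"
| "sat M (Eq t u) \<rho> = (eval M \<rho> t = eval M \<rho> u)"
| "sat M (Neg \<phi>) \<rho> = (\<not> sat M \<phi> \<rho>)"
| "sat M (Conj \<phi> \<psi>) \<rho> = (sat M \<phi> \<rho> \<and> sat M \<psi> \<rho>)"
| "sat M (Ex x \<phi>) \<rho> = (\<exists>m \<in> carrier M (snd x). sat M \<phi> (\<rho>(x := m)))"

definition equivalent :: "('f, 'v, 's) model \<Rightarrow> ('f, 'v, 's) constr \<Rightarrow> ('f, 'v, 's) constr \<Rightarrow> bool" where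
  "equivalent M \<phi> \<psi> \<longleftrightarrow> (\<forall>\<rho>. valuation M \<rho> \<longrightarrow> sat M \<phi> \<rho> = sat M \<psi> \<rho>)"

definition satisfiable :: "('f, 'v, 's) model \<Rightarrow> ('f, 'v, 's) constr \<Rightarrow> bool" where
  "satisfiable M \<phi> \<longleftrightarrow> (\<exists>\<rho>. valuation M \<rho> \<and> sat M \<phi> \<rho>)"

(* The value of a ground term; the second argument of eval is irrelevant for ground terms. *)
abbreviation gval :: "('f, 'v, 's) model \<Rightarrow> ('f, 'v, 's) tm \<Rightarrow> ('f, 'v, 's) tm" where
  "gval M \<equiv> eval M Var"

inductive ra_step :: "('f, 'v, 's) model \<Rightarrow> ('f, 'v, 's) tm \<Rightarrow> ('f, 'v, 's) tm \<Rightarrow> bool"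
  for M :: "('f, 'v, 's) model" where
  rule: "(l, r, \<phi>) \<in> Ra M \<Longrightarrow> ground_subst M \<gamma> \<Longrightarrow> sat M \<phi> (gval M \<circ> \<gamma>) \<Longrightarrow>
         ra_step M (tsubst \<gamma> l) (tsubst \<gamma> r)"
| builtin: "(f, ss, s) \<in> Fb M \<Longrightarrow> ss \<noteq> [] \<Longrightarrow> carriers M ms ss \<Longrightarrow>
         ra_step M (Fun f ms) (interp M f ms)"
| ctxt: "ra_step M t t' \<Longrightarrow> ra_step M (Fun f (us @ t # vs)) (Fun f (us @ t' # vs))"

definition ra_nf :: "('f, 'v, 's) model \<Rightarrow> ('f, 'v, 's) tm \<Rightarrow> ('f, 'v, 's) tm \<Rightarrow> bool" where
  "ra_nf M t n \<longleftrightarrow> (ra_step M)\<^sup>*\<^sup>* t n \<and> (\<nexists>u. ra_step M n u)"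

definition ra_convergent :: "('f, 'v, 's) model \<Rightarrow> bool" where
  "ra_convergent M \<longleftrightarrow>
    (\<forall>s t. ground_of_sort M s t \<longrightarrow>
      (\<nexists>f. f 0 = t \<and> (\<forall>i::nat. ra_step M (f i) (f (Suc i)))) \<and>
      (\<forall>u v. (ra_step M)\<^sup>*\<^sup>* t u \<longrightarrow> (ra_step M)\<^sup>*\<^sup>* t v \<longrightarrow>
        (\<exists>w. (ra_step M)\<^sup>*\<^sup>* u w \<and> (ra_step M)\<^sup>*\<^sup>* v w)))"

definition wf_signature :: "('f, 'v, 's) model \<Rightarrow> bool" where
  "wf_signature M \<longleftrightarrow>
    reflp (sle M) \<and> transp (sle M) \<and> antisymp (sle M) \<and>
    (\<forall>s s'. sle M s s' \<longrightarrow> s' \<in> bsorts M \<longrightarrow> s = s') \<and>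
    fst ` Fb M \<inter> fst ` Fc M = {} \<and> fst ` Fb M \<inter> fst ` Fa M = {} \<and> fst ` Fc M \<inter> fst ` Fa M = {} \<and>
    (\<forall>(f, ss, s) \<in> Fb M. set ss \<subseteq> bsorts M \<and> s \<in> bsorts M) \<and>
    (\<forall>(f, ss, s) \<in> Fc M. s \<notin> bsorts M) \<and>
    bool_sort M \<in> bsorts M"

definition of_bool_tm :: "('f, 'v, 's) model \<Rightarrow> bool \<Rightarrow> ('f, 'v, 's) tm" where
  "of_bool_tm M b = Fun (if b then true_sym M else false_sym M) []"

definition standard_bool :: "('f, 'v, 's) model \<Rightarrow> bool" where
  "standard_bool M \<longleftrightarrow>
    true_sym M \<noteq> false_sym M \<and>
    carrier M (bool_sort M) = {of_bool_tm M True, of_bool_tm M False} \<and>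
    (not_sym M, [bool_sort M], bool_sort M) \<in> Fb M \<and>
    (and_sym M, [bool_sort M, bool_sort M], bool_sort M) \<in> Fb M \<and>
    (or_sym M, [bool_sort M, bool_sort M], bool_sort M) \<in> Fb M \<and>
    (\<forall>a b. interp M (not_sym M) [of_bool_tm M a] = of_bool_tm M (\<not> a) \<and>
      interp M (and_sym M) [of_bool_tm M a, of_bool_tm M b] = of_bool_tm M (a \<and> b) \<and>
      interp M (or_sym M) [of_bool_tm M a, of_bool_tm M b] = of_bool_tm M (a \<or> b))"

(* Since ra_step evaluates the constraints of Ra in M, the clause for Fa is a fixed-point
   condition on interp.  On a builtin sort, carrier consists of the builtin constants only,
   because constructors never have a builtin result sort and builtin sorts have no subsorts. *)
definition wf_setting :: "('f, 'v, 's) model \<Rightarrow> bool" where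
  "wf_setting M \<longleftrightarrow>
    wf_signature M \<and> standard_bool M \<and>
    (\<forall>(f, ss, s) \<in> Fb M. \<forall>ms. carriers M ms ss \<longrightarrow> interp M f ms \<in> carrier M s) \<and>
    (\<forall>(c, ss, s) \<in> bconsts M. interp M c [] = Fun c []) \<and>
    (\<forall>(f, ss, s) \<in> Fc M. \<forall>ms. carriers M ms ss \<longrightarrow> interp M f ms = Fun f ms) \<and>
    (\<forall>(f, ss, s) \<in> Fa M. \<forall>ms. carriers M ms ss \<longrightarrow> ra_nf M (Fun f ms) (interp M f ms)) \<and>
    (\<forall>\<rho> \<in> Ra M. \<exists>s. wf_rule M s \<rho>) \<and>
    ra_convergent M \<and>
    (\<forall>s t n. ground_of_sort M s t \<longrightarrow> ra_nf M t n \<longrightarrow> n \<in> carrier M s)"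


section \<open>Top-most rewrite systems and partial simulation\<close>

definition topmost_lctrs :: "('f, 'v, 's) model \<Rightarrow> 's \<Rightarrow> ('f, 'v, 's) rule set \<Rightarrow> bool" where
  "topmost_lctrs M cfg R \<longleftrightarrow> (\<forall>\<rho> \<in> R. wf_rule M cfg \<rho>)"

definition transition ::
  "('f, 'v, 's) model \<Rightarrow> ('f, 'v, 's) rule set \<Rightarrow> ('f, 'v, 's) tm \<Rightarrow> ('f, 'v, 's) tm \<Rightarrow> bool" where
  "transition M R \<gamma> \<gamma>' \<longleftrightarrow>
    (\<exists>l r \<phi> \<rho>. (l, r, \<phi>) \<in> R \<and> valuation M \<rho> \<and> sat M \<phi> \<rho> \<and> \<gamma> = eval M \<rho> l \<and> \<gamma>' = eval M \<rho> r)"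

definition syn_step ::
  "('f, 'v, 's) model \<Rightarrow> ('f, 'v, 's) rule set \<Rightarrow> ('f, 'v, 's) tm \<Rightarrow> ('f, 'v, 's) tm \<Rightarrow> bool" where
  "syn_step M R u v \<longleftrightarrow>
    (\<exists>l r \<phi> \<gamma>. (l, r, \<phi>) \<in> R \<and> ground_subst M \<gamma> \<and> sat M \<phi> (gval M \<circ> \<gamma>) \<and>
      u = tsubst \<gamma> l \<and> v = tsubst \<gamma> r)"

(* Ground coherence: a syntactic step of R from u can be simulated from the Ra-normal form of u,
   up to Ra-normalization of the results. *)
definition coherent :: "('f, 'v, 's) model \<Rightarrow> ('f, 'v, 's) rule set \<Rightarrow> bool" where
  "coherent M R \<longleftrightarrow>
    (\<forall>u v. syn_step M R u v \<longrightarrow>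
      (\<exists>u' v' n. ra_nf M u u' \<and> syn_step M R u' v' \<and> ra_nf M v n \<and> ra_nf M v' n))"

definition terminal ::
  "('f, 'v, 's) model \<Rightarrow> ('f, 'v, 's) rule set \<Rightarrow> ('f, 'v, 's) tm \<Rightarrow> bool" where
  "terminal M R \<gamma> \<longleftrightarrow> (\<nexists>\<gamma>'. transition M R \<gamma> \<gamma>')"

definition complete_path ::
  "('f, 'v, 's) model \<Rightarrow> ('f, 'v, 's) rule set \<Rightarrow> ('f, 'v, 's) tm \<Rightarrow> ('f, 'v, 's) tm \<Rightarrow> bool" where
  "complete_path M R \<gamma> \<gamma>' \<longleftrightarrow> (transition M R)\<^sup>*\<^sup>* \<gamma> \<gamma>' \<and> terminal M R \<gamma>'"

definition infinite_path ::
  "('f, 'v, 's) model \<Rightarrow> ('f, 'v, 's) rule set \<Rightarrow> ('f, 'v, 's) tm \<Rightarrow> bool" where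
  "infinite_path M R \<gamma> \<longleftrightarrow> (\<exists>f. f 0 = \<gamma> \<and> (\<forall>i::nat. transition M R (f i) (f (Suc i))))"

definition base_cases ::
  "('f, 'v, 's) model \<Rightarrow> 's \<Rightarrow> 's \<Rightarrow> ('f, 'v, 's) rule set \<Rightarrow> ('f, 'v, 's) rule set \<Rightarrow>
   (('f, 'v, 's) tm \<times> ('f, 'v, 's) tm) set \<Rightarrow> bool" where
  "base_cases M cfgL cfgR RL RR BB \<longleftrightarrow>
    (\<forall>(p, q) \<in> BB. p \<in> carrier M cfgL \<and> terminal M RL p \<and> q \<in> carrier M cfgR \<and> terminal M RR q)"

definition wf_psf :: "('f, 'v, 's) model \<Rightarrow> 's \<Rightarrow> 's \<Rightarrow> ('f, 'v, 's) psf \<Rightarrow> bool" where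
  "wf_psf M cfgL cfgR =
    (\<lambda>(P, Q, \<phi>). term_of_sort M cfgL P \<and> term_of_sort M cfgR Q \<and> wf_constr M \<phi>)"

definition partial_sim ::
  "('f, 'v, 's) model \<Rightarrow> ('f, 'v, 's) rule set \<Rightarrow> ('f, 'v, 's) rule set \<Rightarrow>
   (('f, 'v, 's) tm \<times> ('f, 'v, 's) tm) set \<Rightarrow> ('f, 'v, 's) psf \<Rightarrow> bool" where
  "partial_sim M RL RR BB = (\<lambda>(P, Q, \<phi>).
    \<forall>\<rho> P'. valuation M \<rho> \<longrightarrow> sat M \<phi> \<rho> \<longrightarrow> complete_path M RL (eval M \<rho> P) P' \<longrightarrow>
      (\<exists>Q'. complete_path M RR (eval M \<rho> Q) Q' \<and> (P', Q') \<in> BB) \<or>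
      infinite_path M RR (eval M \<rho> Q))"

definition denot ::
  "('f, 'v, 's) model \<Rightarrow> ('f, 'v, 's) psf set \<Rightarrow> (('f, 'v, 's) tm \<times> ('f, 'v, 's) tm) set" where
  "denot M R =
    {(eval M \<rho> P, eval M \<rho> Q) | P Q \<phi> \<rho>. (P, Q, \<phi>) \<in> R \<and> valuation M \<rho> \<and> sat M \<phi> \<rho>}"


section \<open>Unification modulo axiomatized symbols and derivatives\<close>

(* Besides soundness and completeness, unifiers are in solved form: \<sigma> is idempotent, and \<phi>
   only mentions variables that \<sigma> leaves unchanged. *)
definition is_umas :: "('f, 'v, 's) model \<Rightarrow> ('f, 'v, 's) umas_fun \<Rightarrow> bool" where
  "is_umas M umas \<longleftrightarrow>
    (\<forall>s t1 t2. term_of_sort M s t1 \<longrightarrow> term_of_sort M s t2 \<longrightarrow>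
      (\<forall>(\<phi>, \<sigma>) \<in> umas t1 t2.
        builtin_constr M \<phi> \<and> wf_subst M \<sigma> \<and>
        (\<forall>x. tsubst \<sigma> (\<sigma> x) = \<sigma> x) \<and> (\<forall>x \<in> fv \<phi>. \<sigma> x = Var x) \<and>
        (\<forall>\<rho>. valuation M \<rho> \<longrightarrow> sat M \<phi> \<rho> \<longrightarrow>
          eval M \<rho> (tsubst \<sigma> t1) = eval M \<rho> (tsubst \<sigma> t2))) \<and>
      (\<forall>\<rho>. valuation M \<rho> \<longrightarrow> eval M \<rho> t1 = eval M \<rho> t2 \<longrightarrow>
        (\<exists>(\<phi>, \<sigma>) \<in> umas t1 t2. \<exists>\<rho>'. valuation M \<rho>' \<and> \<rho> = eval M \<rho>' \<circ> \<sigma> \<and> sat M \<phi> \<rho>')))"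

(* The substitution \<sigma>' is part of the constraint of a derivative.  It is applied to the rule,
   whose variables are local, but only recorded as equations for the variables of t, which may
   also occur elsewhere: without the equations, t = c(x) and the rule c(0) \<rightarrow> d would yield
   the derivative d if Top although c(1) has no successor. *)
definition deriv_constr ::
  "('f, 'v, 's) ctm \<Rightarrow> ('f, 'v, 's) constr \<Rightarrow> ('f, 'v, 's) constr \<Rightarrow> ('f, 'v, 's) sub \<Rightarrow>
   ('f, 'v, 's) constr" where
  "deriv_constr = (\<lambda>(t, \<phi>) \<phi>lr \<phi>' \<sigma>'.
    conjs ([\<phi>, \<phi>', fsubst \<phi>lr \<sigma>'] @ map (\<lambda>x. Eq (Var x) (\<sigma>' x)) (vars_list t)))"

definition Delta_rule ::
  "('f, 'v, 's) model \<Rightarrow> ('f, 'v, 's) umas_fun \<Rightarrow> ('f, 'v, 's) rule \<Rightarrow> ('f, 'v, 's) ctm \<Rightarrow>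
   ('f, 'v, 's) ctm set" where
  "Delta_rule M umas = (\<lambda>(l, r, \<phi>lr) (t, \<phi>).
    {(tsubst \<sigma>' r, deriv_constr (t, \<phi>) \<phi>lr \<phi>' \<sigma>') | \<phi>' \<sigma>'.
      (\<phi>', \<sigma>') \<in> umas t l \<and> satisfiable M (deriv_constr (t, \<phi>) \<phi>lr \<phi>' \<sigma>')})"

(* W: further variables from which the variables of the rules are kept apart. *)
definition Delta ::
  "('f, 'v, 's) model \<Rightarrow> ('f, 'v, 's) umas_fun \<Rightarrow> ('v, 's) var set \<Rightarrow> ('f, 'v, 's) rule set \<Rightarrow>
   ('f, 'v, 's) ctm \<Rightarrow> ('f, 'v, 's) ctm set" where
  "Delta M umas W R = (\<lambda>(t, \<phi>).
    \<Union>\<rho> \<in> R. Delta_rule M umas (apart (W \<union> vars t \<union> fv \<phi>) \<rho>) (t, \<phi>))"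

definition Delta_between ::
  "('f, 'v, 's) model \<Rightarrow> ('f, 'v, 's) umas_fun \<Rightarrow> ('v, 's) var set \<Rightarrow> ('f, 'v, 's) rule set \<Rightarrow>
   nat \<Rightarrow> nat \<Rightarrow> ('f, 'v, 's) tm \<Rightarrow> ('f, 'v, 's) ctm set" where
  "Delta_between M umas W R a k Q =
    (\<Union>i \<in> {a..k}. ((\<lambda>S. \<Union>ct \<in> S. Delta M umas W R ct) ^^ i) {(Q, Top)})"


section \<open>The proof system\<close>

(* Satisfaction of sub((P,Q),R) under \<rho>; since the variables of R are disjoint from those of
   P and Q, they are existentially quantified by an independent valuation. *)
definition sat_sub ::
  "('f, 'v, 's) model \<Rightarrow> ('f, 'v, 's) sub \<Rightarrow> ('f, 'v, 's) tm \<Rightarrow> ('f, 'v, 's) tm \<Rightarrow>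
   ('f, 'v, 's) psf set \<Rightarrow> bool" where
  "sat_sub M \<rho> P Q R \<longleftrightarrow>
    (\<exists>(P', Q', \<phi>') \<in> R. \<exists>\<rho>'. valuation M \<rho>' \<and> sat M \<phi>' \<rho>' \<and>
      eval M \<rho> P = eval M \<rho>' P' \<and> eval M \<rho> Q = eval M \<rho>' Q')"

(* Side condition of Base and Circ.  The variables of a derivative that do not occur in P, Q are
   existentially quantified, and its constraint has to hold: with an implication
   \<phi>' \<longrightarrow> sub(...) in its place, the condition would hold under every valuation for which
   (Q', \<phi>') is not reachable from Q, and the proof system would be unsound. *)
definition reaches_sub ::
  "('f, 'v, 's) model \<Rightarrow> ('f, 'v, 's) tm \<Rightarrow> ('f, 'v, 's) tm \<Rightarrow> ('f, 'v, 's) ctm set \<Rightarrow>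
   ('f, 'v, 's) psf set \<Rightarrow> ('f, 'v, 's) constr \<Rightarrow> bool" where
  "reaches_sub M P Q D R \<phi> \<longleftrightarrow>
    (\<forall>\<rho>. valuation M \<rho> \<longrightarrow> sat M \<phi> \<rho> \<longrightarrow>
      (\<exists>(Q', \<phi>') \<in> D. \<exists>\<rho>'. valuation M \<rho>' \<and> (\<forall>x \<in> vars P \<union> vars Q. \<rho>' x = \<rho> x) \<and>
        sat M \<phi>' \<rho>' \<and> sat_sub M \<rho>' P Q' R))"

(* derivable M umas RL RR G B g P Q \<phi> stands for the sequent with flag g \<in> {0, 1}; the rule
   equiv identifies constraints that are equivalent in M. *)
inductive derivable ::
  "('f, 'v, 's) model \<Rightarrow> ('f, 'v, 's) umas_fun \<Rightarrow> ('f, 'v, 's) rule set \<Rightarrow> ('f, 'v, 's) rule set \<Rightarrow>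
   ('f, 'v, 's) psf set \<Rightarrow> ('f, 'v, 's) psf set \<Rightarrow>
   nat \<Rightarrow> ('f, 'v, 's) tm \<Rightarrow> ('f, 'v, 's) tm \<Rightarrow> ('f, 'v, 's) constr \<Rightarrow> bool"
  for M :: "('f, 'v, 's) model" and umas :: "('f, 'v, 's) umas_fun"
    and RL RR :: "('f, 'v, 's) rule set" and G B :: "('f, 'v, 's) psf set" where
  equiv: "derivable M umas RL RR G B g P Q \<psi> \<Longrightarrow> wf_constr M \<psi> \<Longrightarrow> equivalent M \<phi> \<psi> \<Longrightarrow>
    derivable M umas RL RR G B g P Q \<phi>"
| axiom: "derivable M umas RL RR G B g P Q Bot"
| base: "derivable M umas RL RR G B g P Q (Conj \<phi> (Neg \<phi>B)) \<Longrightarrow> wf_constr M \<phi>B \<Longrightarrow>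
    reaches_sub M P Q (Delta_between M umas (vars P) RR 0 k Q) B \<phi>B \<Longrightarrow>
    derivable M umas RL RR G B g P Q \<phi>"
| circ: "derivable M umas RL RR G B g P Q (Conj \<phi> (Neg \<phi>G)) \<Longrightarrow> wf_constr M \<phi>G \<Longrightarrow>
    reaches_sub M P Q (Delta_between M umas (vars P) RR (1 - g) k Q) G \<phi>G \<Longrightarrow>
    derivable M umas RL RR G B g P Q \<phi>"
| step: "set cts = Delta M umas (vars Q) RL (P, \<phi>) \<Longrightarrow>
    (\<And>P' \<phi>'. (P', \<phi>') \<in> set cts \<Longrightarrow> derivable M umas RL RR G B 1 P' Q \<phi>') \<Longrightarrow>
    derivable M umas RL RR G B g P Q (Conj \<phi> (conjs (map (\<lambda>(P', \<phi>'). Neg \<phi>') cts))) \<Longrightarrow>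
    derivable M umas RL RR G B g P Q \<phi>"

definition derivable_set ::
  "('f, 'v, 's) model \<Rightarrow> ('f, 'v, 's) umas_fun \<Rightarrow> ('f, 'v, 's) rule set \<Rightarrow> ('f, 'v, 's) rule set \<Rightarrow>
   ('f, 'v, 's) psf set \<Rightarrow> ('f, 'v, 's) psf set \<Rightarrow> nat \<Rightarrow> ('f, 'v, 's) psf set \<Rightarrow> bool" where
  "derivable_set M umas RL RR G B g G' \<longleftrightarrow>
    (\<forall>(P, Q, \<phi>) \<in> G'. derivable M umas RL RR G B g P Q \<phi>)"

end

theory Submission
  imports Defs
begin

text \<open>
  Since unifiers are idempotent and their constraints only mention variables they fix, a valuation
  that realises a transition of a configuration satisfies the constraint of the corresponding
  derivative itself, and conversely. Soundness is then shown by strong induction on the length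
  of the complete left path: after a left step the flag is \<open>1\<close> and the path is shorter, so
  a use of Circ is covered by the induction hypothesis. With flag \<open>0\<close>, Circ keeps the left
  path but makes at least one right step into the denotation of \<open>G\<close>; if this repeats forever,
  the right side has an infinite path.
\<close>

section \<open>Evaluation and substitution\<close>

lemma finite_vars [simp]: "finite (vars t)"
  by (induction t) auto

lemma finite_fv [simp]: "finite (fv \<phi>)"
  by (induction \<phi>) auto

lemma set_vars_list [simp]: "set (vars_list t) = vars t"
  by (induction t) auto

lemma eval_cong: "(\<And>x. x \<in> vars t \<Longrightarrow> \<rho> x = \<rho>' x) \<Longrightarrow> eval M \<rho> t = eval M \<rho>' t"
proof (induction t)
  case (Fun f ts)
  have "eval M \<rho> u = eval M \<rho>' u" if "u \<in> set ts" for u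
    by (rule Fun.IH[OF that], rule Fun.prems, use that in auto)
  then have "map (eval M \<rho>) ts = map (eval M \<rho>') ts" by simp
  then show ?case by (simp only: eval.simps)
qed simp

lemma eval_tsubst: "eval M \<rho> (tsubst \<sigma> t) = eval M (eval M \<rho> \<circ> \<sigma>) t"
  by (induction t) (auto intro!: arg_cong[where f = "interp M _"])

lemma sat_cong: "(\<And>x. x \<in> fv \<phi> \<Longrightarrow> \<rho> x = \<rho>' x) \<Longrightarrow> sat M \<phi> \<rho> = sat M \<phi> \<rho>'"
proof (induction \<phi> arbitrary: \<rho> \<rho>')
  case (Eq t u)
  then show ?case using eval_cong[of t \<rho> \<rho>' M] eval_cong[of u \<rho> \<rho>' M] by simp
next
  case (Neg \<phi>)
  then show ?case by (metis fv.simps(3) sat.simps(3))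
next
  case (Conj \<phi> \<psi>)
  then show ?case by (metis UnCI fv.simps(4) sat.simps(4))
next
  case (Ex x \<phi>)
  have "sat M \<phi> (\<rho>(x := m)) = sat M \<phi> (\<rho>'(x := m))" for m
    by (rule Ex.IH) (use Ex.prems in auto)
  then show ?case by simp
qed simp_all

lemma sat_conjs [simp]: "sat M (conjs \<phi>s) \<rho> \<longleftrightarrow> (\<forall>\<phi> \<in> set \<phi>s. sat M \<phi> \<rho>)"
  by (induction \<phi>s) (auto simp: conjs_def)

text \<open>Names range over an infinite type and are paired with sorts, so finitely many variables
  exhaust no sort. This makes the choice of bound variable in \<open>fsubst\<close> well
  defined.\<close>

lemma ex_fresh_of_sort:
  fixes A :: "('v::infinite \<times> 's) set"
  assumes "finite A"
  shows "\<exists>y. snd y = s \<and> y \<notin> A"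
proof -
  obtain v where "v \<notin> fst ` A"
    using assms ex_new_if_finite[OF infinite_UNIV, of "fst ` A"] by blast
  then have "snd (v, s) = s \<and> (v, s) \<notin> A" by force
  then show ?thesis by blast
qed

text \<open>The substitution lemma survives quantifiers because the new bound variable has the sort
  of the old one, hence the same range, and does not occur in the images of the other free
  variables, hence updating it changes no other value.\<close>

lemma sat_fsubst:
  fixes \<phi> :: "('f, 'v::infinite, 's) constr"
  shows "sat M (fsubst \<phi> \<sigma>) \<rho> = sat M \<phi> (eval M \<rho> \<circ> \<sigma>)"
proof (induction \<phi> arbitrary: \<sigma> \<rho>)
  case (Ex x \<phi>)
  define y where "y = (SOME y. snd y = snd x \<and> y \<notin> (\<Union>z \<in> fv \<phi> - {x}. vars (\<sigma> z)))"
  have y: "snd y = snd x" "y \<notin> (\<Union>z \<in> fv \<phi> - {x}. vars (\<sigma> z))"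
    using someI_ex[OF ex_fresh_of_sort[of "\<Union>z \<in> fv \<phi> - {x}. vars (\<sigma> z)" "snd x"]]
    unfolding y_def by auto
  have "sat M \<phi> (eval M (\<rho>(y := m)) \<circ> \<sigma>(x := Var y)) = sat M \<phi> ((eval M \<rho> \<circ> \<sigma>)(x := m))" for m
    by (rule sat_cong) (use y in \<open>auto intro!: eval_cong\<close>)
  then show ?case
    by (simp only: fsubst.simps Let_def y_def[symmetric] sat.simps y(1) Ex.IH)
qed (simp_all add: eval_tsubst)

lemma map_trm_eq_tsubst: "map_trm id \<pi> t = tsubst (Var \<circ> \<pi>) t"
  by (induction t) auto

lemma eval_rename: "eval M \<rho> (map_trm id \<pi> t) = eval M (\<rho> \<circ> \<pi>) t"
proof -
  have "eval M \<rho> \<circ> (Var \<circ> \<pi>) = \<rho> \<circ> \<pi>" by auto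
  then show ?thesis by (simp add: map_trm_eq_tsubst eval_tsubst)
qed

text \<open>\<open>map_fm\<close> also renames bound variables. Injectivity keeps an update at
  \<open>\<pi> x\<close> from affecting other variables, and preservation of sorts keeps the range
  of each quantifier.\<close>

lemma sat_rename:
  assumes "inj \<pi>" and "\<And>x. snd (\<pi> x) = snd x"
  shows "sat M (map_fm id \<pi> \<phi>) \<rho> = sat M \<phi> (\<rho> \<circ> \<pi>)"
proof (induction \<phi> arbitrary: \<rho>)
  case (Ex x \<phi>)
  have "\<rho>(\<pi> x := m) \<circ> \<pi> = (\<rho> \<circ> \<pi>)(x := m)" for m
    using \<open>inj \<pi>\<close> by (auto simp: fun_eq_iff inj_eq)
  then show ?case by (simp only: fm.map sat.simps assms(2) Ex.IH)
qed (simp_all add: eval_rename)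


section \<open>Sorts\<close>

lemma has_sort_mono:
  assumes "has_sort le D t s" and "D \<subseteq> D'"
  shows "has_sort le D' t s"
  using assms(1)
proof (induction rule: has_sort.induct)
  case (app f ss s ts)
  then show ?case
    using assms(2) by (auto intro!: has_sort.app elim!: list_all2_mono)
qed (auto intro: has_sort.intros)

lemma has_sort_tsubst:
  assumes "has_sort le D t s" and "\<And>x. has_sort le D (\<sigma> x) (snd x)"
  shows "has_sort le D (tsubst \<sigma> t) s"
  using assms(1)
proof (induction rule: has_sort.induct)
  case (app f ss s ts)
  then show ?case
    by (auto intro!: has_sort.app simp: list_all2_conv_all_nth)
qed (auto intro: has_sort.intros assms(2))

lemma term_of_sort_tsubst:
  "term_of_sort M s t \<Longrightarrow> wf_subst M \<sigma> \<Longrightarrow> term_of_sort M s (tsubst \<sigma> t)"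
  unfolding term_of_sort_def wf_subst_def by (blast intro: has_sort_tsubst)

lemma term_of_sort_rename:
  assumes "term_of_sort M s t" and "\<And>x. snd (\<pi> x) = snd x"
  shows "term_of_sort M s (map_trm id \<pi> t)"
proof -
  have "has_sort (sle M) (Fall M) (Var (\<pi> x)) (snd x)" for x
    using has_sort.var[of _ _ "\<pi> x"] assms(2) by metis
  then show ?thesis
    using has_sort_tsubst[of _ _ t s "Var \<circ> \<pi>"] assms(1)
    unfolding map_trm_eq_tsubst term_of_sort_def o_apply by blast
qed

lemma carrier_subset_ground:
  assumes "m \<in> carrier M s"
  shows "ground_of_sort M s m"
proof -
  have "bconsts M \<union> Fc M \<subseteq> Fall M" by (auto simp: bconsts_def Fall_def)
  then show ?thesis
    using assms has_sort_mono
    by (fastforce simp: carrier_def ground_of_sort_def term_of_sort_def)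
qed

text \<open>Closure is assumed for builtin symbols and follows from free interpretation for
  constructors. For axiomatized symbols the value is a normal form of a ground term, and such normal
  forms lie in the carrier.\<close>

lemma interp_in_carrier:
  assumes "wf_setting M" and f: "(f, ss, s) \<in> Fall M" and ms: "carriers M ms ss"
  shows "interp M f ms \<in> carrier M s"
proof -
  have ground: "\<forall>m \<in> set ms. vars m = {}"
    using ms by (auto simp: list_all2_conv_all_nth carrier_def in_set_conv_nth)
  consider "(f, ss, s) \<in> Fb M" | "(f, ss, s) \<in> Fc M" | "(f, ss, s) \<in> Fa M"
    using f by (auto simp: Fall_def)
  then show ?thesis
  proof cases
    case 1
    then show ?thesis using assms by (auto simp: wf_setting_def)
  next
    case 2
    have "list_all2 (has_sort (sle M) (bconsts M \<union> Fc M)) ms ss"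
      using ms by (auto simp: carrier_def elim: list_all2_mono)
    with 2 have "Fun f ms \<in> carrier M s"
      using ground by (auto simp: carrier_def intro: has_sort.app)
    moreover have "interp M f ms = Fun f ms"
      using 2 assms by (auto simp: wf_setting_def)
    ultimately show ?thesis by simp
  next
    case 3
    have "list_all2 (has_sort (sle M) (Fall M)) ms ss"
      using ms by (rule list_all2_mono)
        (auto dest: carrier_subset_ground simp: ground_of_sort_def term_of_sort_def)
    then have "ground_of_sort M s (Fun f ms)"
      using f ground by (auto simp: ground_of_sort_def term_of_sort_def intro: has_sort.app)
    moreover have "ra_nf M (Fun f ms) (interp M f ms)"
      using 3 assms by (auto simp: wf_setting_def)
    ultimately show ?thesis using assms(1) by (auto simp: wf_setting_def)
  qed
qed

lemma eval_in_carrier: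
  assumes "wf_setting M" and "valuation M \<rho>" and "term_of_sort M s t"
  shows "eval M \<rho> t \<in> carrier M s"
  using assms(3) unfolding term_of_sort_def
proof (induction rule: has_sort.induct)
  case (var x)
  then show ?case using assms(2) unfolding valuation_def eval.simps by blast
next
  case (app f ss s ts)
  have "carriers M (map (eval M \<rho>) ts) ss"
    using app.IH by (auto simp: list_all2_conv_all_nth)
  then show ?case using interp_in_carrier[OF assms(1) app.hyps] by simp
next
  case (subsort t s s')
  then show ?case by (auto simp: carrier_def intro: has_sort.subsort)
qed

lemma valuation_eval_comp:
  "wf_setting M \<Longrightarrow> valuation M \<rho> \<Longrightarrow> wf_subst M \<sigma> \<Longrightarrow> valuation M (eval M \<rho> \<circ> \<sigma>)"
  by (auto simp: valuation_def[of _ "_ \<circ> _"] wf_subst_def intro: eval_in_carrier)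


section \<open>Variants of rules\<close>

lemma vars_rename: "vars (map_trm id \<pi> t) = \<pi> ` vars t"
  by (induction t) auto

lemma fv_rename: "inj \<pi> \<Longrightarrow> fv (map_fm id \<pi> \<phi>) = \<pi> ` fv \<phi>"
  by (induction \<phi>) (auto simp: vars_rename inj_eq)

lemma rule_vars_rename: "inj \<pi> \<Longrightarrow> rule_vars (rename_rule \<pi> R) = \<pi> ` rule_vars R"
  by (auto simp: rule_vars_def rename_rule_def vars_rename fv_rename split: prod.splits)

text \<open>A variant needs a bijection of all names, not just an injection on \<open>A\<close>;
  exchanging \<open>A\<close> with an equally large set outside \<open>A\<close> and
  \<open>W\<close> provides one.\<close>

lemma ex_bij_avoiding:
  fixes A W :: "'v::infinite set"
  assumes "finite A" and "finite W"
  shows "\<exists>p. bij p \<and> p ` A \<inter> W = {}"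
proof -
  have "infinite (- (A \<union> W))" using assms by (metis finite_UnI finite_compl infinite_UNIV)
  then obtain B where B: "finite B" "card B = card A" "B \<subseteq> - (A \<union> W)"
    using infinite_arbitrarily_large by metis
  then obtain h where h: "bij_betw h A B"
    using finite_same_card_bij assms(1) by metis
  \<comment> \<open>\<open>p\<close> swaps \<open>A\<close> and \<open>B\<close> along
    \<open>h\<close> and fixes all else, so it is an involution and therefore bijective.\<close>
  define p where "p v = (if v \<in> A then h v else if v \<in> B then inv_into A h v else v)" for v
  have hB: "h v \<in> B" "h v \<notin> A" if "v \<in> A" for v
    using h that B(3) by (auto simp: bij_betw_def)
  have inv: "inv_into A h v \<in> A" "h (inv_into A h v) = v" if "v \<in> B" for v
    using h that by (auto simp: bij_betw_def inv_into_into f_inv_into_f)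
  have "inv_into A h (h v) = v" if "v \<in> A" for v
    using h that by (auto simp: bij_betw_def)
  then have "p (p v) = v" for v
    using hB inv B(3) by (auto simp: p_def)
  then have "bij p" by (intro o_bij[of p p]) auto
  moreover have "p ` A \<inter> W = {}" using hB B(3) by (auto simp: p_def)
  ultimately show ?thesis by blast
qed

text \<open>This justifies the choice in \<open>apart\<close>. Renaming only the name component
  preserves sorts, and disjointness of the names implies disjointness of the variables.\<close>

lemma is_variant_apart:
  fixes R :: "('f, 'v::infinite, 's) rule"
  assumes "finite W"
  shows "is_variant W R (apart W R)"
proof -
  have "finite (rule_vars R)" by (auto simp: rule_vars_def split: prod.splits)
  then obtain p where p: "bij p" "p ` fst ` rule_vars R \<inter> fst ` W = {}"
    using ex_bij_avoiding[of "fst ` rule_vars R" "fst ` W"] assms by auto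
  define \<pi> :: "('v, 's) var \<Rightarrow> ('v, 's) var" where "\<pi> = map_prod p id"
  have "bij \<pi>"
    using p(1) unfolding \<pi>_def bij_def by (simp add: prod.inj_map map_prod_surj)
  moreover have "\<forall>x. snd (\<pi> x) = snd x" by (simp add: \<pi>_def)
  moreover have "rule_vars (rename_rule \<pi> R) \<inter> W = {}"
    using p(2) \<open>bij \<pi>\<close> by (force simp: rule_vars_rename bij_is_inj \<pi>_def)
  ultimately have "is_variant W R (rename_rule \<pi> R)" by (auto simp: is_variant_def)
  then show ?thesis unfolding apart_def by (rule someI)
qed

lemma apart_cases:
  fixes R :: "('f, 'v::infinite, 's) rule"
  assumes "finite W" and "apart W R = (l', r', \<phi>')"
  obtains l r \<phi> \<pi> where "R = (l, r, \<phi>)" "bij \<pi>" "\<And>x. snd (\<pi> x) = snd x"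
    "l' = map_trm id \<pi> l" "r' = map_trm id \<pi> r" "\<phi>' = map_fm id \<pi> \<phi>"
    "(vars l' \<union> vars r' \<union> fv \<phi>') \<inter> W = {}"
  using is_variant_apart[OF assms(1), of R] assms(2)
  by (cases R) (auto simp: is_variant_def rename_rule_def rule_vars_def)


section \<open>Derivatives\<close>

lemma is_umasD:
  assumes "is_umas M umas" and "term_of_sort M s t" and "term_of_sort M s u"
    and "(\<phi>, \<sigma>) \<in> umas t u"
  shows "wf_subst M \<sigma>" and "\<And>x. tsubst \<sigma> (\<sigma> x) = \<sigma> x" and "\<And>x. x \<in> fv \<phi> \<Longrightarrow> \<sigma> x = Var x"
    and "\<And>\<rho>. valuation M \<rho> \<Longrightarrow> sat M \<phi> \<rho> \<Longrightarrow> eval M \<rho> (tsubst \<sigma> t) = eval M \<rho> (tsubst \<sigma> u)"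
  using assms unfolding is_umas_def by blast+

lemma is_umas_complete:
  assumes "is_umas M umas" and "term_of_sort M s t" and "term_of_sort M s u"
    and "valuation M \<rho>" and "eval M \<rho> t = eval M \<rho> u"
  obtains \<phi> \<sigma> \<rho>' where "(\<phi>, \<sigma>) \<in> umas t u" "\<rho> = eval M \<rho>' \<circ> \<sigma>" "sat M \<phi> \<rho>'"
  using assms unfolding is_umas_def by blast

lemma sat_deriv_constr:
  fixes \<phi> :: "('f, 'v::infinite, 's) constr"
  shows "sat M (deriv_constr (t, \<phi>) \<phi>lr \<phi>' \<sigma>) \<rho> \<longleftrightarrow>
    sat M \<phi> \<rho> \<and> sat M \<phi>' \<rho> \<and> sat M \<phi>lr (eval M \<rho> \<circ> \<sigma>) \<and> (\<forall>x \<in> vars t. \<rho> x = eval M \<rho> (\<sigma> x))"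
  by (auto simp: deriv_constr_def sat_fsubst)

text \<open>The equations recorded in a derivative's constraint force \<open>\<rho>\<close> to agree
  with its composition with the unifier on the variables of \<open>t\<close>. Soundness of the
  unifier then makes \<open>t\<close> an instance of the left-hand side under the same
  \<open>\<rho>\<close>.\<close>

lemma Delta_sound:
  fixes M :: "('f, 'v::infinite, 's) model"
  assumes "wf_setting M" and "is_umas M umas" and "topmost_lctrs M cfg R" and "finite W"
    and "term_of_sort M cfg t" and "(t', \<phi>') \<in> Delta M umas W R (t, \<phi>)"
  shows "term_of_sort M cfg t'"
    and "\<And>\<rho>. valuation M \<rho> \<Longrightarrow> sat M \<phi>' \<rho> \<Longrightarrow>
      sat M \<phi> \<rho> \<and> transition M R (eval M \<rho> t) (eval M \<rho> t')"
proof -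
  let ?W = "W \<union> vars t \<union> fv \<phi>"
  obtain R0 where R0: "R0 \<in> R" and in_Delta: "(t', \<phi>') \<in> Delta_rule M umas (apart ?W R0) (t, \<phi>)"
    using assms(6) by (auto simp: Delta_def)
  obtain l' r' \<phi>lr' where apart: "apart ?W R0 = (l', r', \<phi>lr')" by (metis prod_cases3)
  with in_Delta obtain \<phi>u \<sigma> where t': "t' = tsubst \<sigma> r'"
    and \<phi>': "\<phi>' = deriv_constr (t, \<phi>) \<phi>lr' \<phi>u \<sigma>" and u: "(\<phi>u, \<sigma>) \<in> umas t l'"
    by (auto simp: Delta_rule_def)
  from apart obtain l r \<phi>lr \<pi> where R0_eq: "R0 = (l, r, \<phi>lr)" and \<pi>: "bij \<pi>" "\<And>x. snd (\<pi> x) = snd x"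
    and variant: "l' = map_trm id \<pi> l" "r' = map_trm id \<pi> r" "\<phi>lr' = map_fm id \<pi> \<phi>lr"
    by (rule apart_cases[rotated]) (use assms(4) in auto)
  have "wf_rule M cfg (l, r, \<phi>lr)"
    using assms(3) R0 R0_eq by (auto simp: topmost_lctrs_def)
  then have sorts: "term_of_sort M cfg l'" "term_of_sort M cfg r'"
    using \<pi>(2) by (auto simp: variant wf_rule_def intro: term_of_sort_rename)
  note umas = is_umasD[OF assms(2,5) sorts(1) u]
  show "term_of_sort M cfg t'"
    unfolding t' using sorts(2) umas(1) by (rule term_of_sort_tsubst)
  fix \<rho> assume \<rho>: "valuation M \<rho>" "sat M \<phi>' \<rho>"
  then have s: "sat M \<phi> \<rho>" "sat M \<phi>u \<rho>" "sat M \<phi>lr' (eval M \<rho> \<circ> \<sigma>)"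
    "\<And>x. x \<in> vars t \<Longrightarrow> \<rho> x = eval M \<rho> (\<sigma> x)"
    by (auto simp: \<phi>' sat_deriv_constr)
  \<comment> \<open>Composing with \<open>\<pi>\<close> turns a valuation of the renamed rule into
    one of the original rule.\<close>
  define \<tau> where "\<tau> = eval M \<rho> \<circ> \<sigma> \<circ> \<pi>"
  have "valuation M \<tau>"
    using valuation_eval_comp[OF assms(1) \<rho>(1) umas(1)] \<pi>(2)
    unfolding \<tau>_def valuation_def by (metis comp_apply)
  moreover have "sat M \<phi>lr \<tau>"
    using s(3) \<pi> by (simp add: \<tau>_def variant sat_rename bij_is_inj)
  moreover have "eval M \<rho> t = eval M \<tau> l"
  proof -
    have "eval M \<rho> t = eval M (eval M \<rho> \<circ> \<sigma>) t" by (rule eval_cong) (simp add: s(4))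
    also have "\<dots> = eval M \<rho> (tsubst \<sigma> l')" using umas(4)[OF \<rho>(1) s(2)] by (simp add: eval_tsubst)
    also have "\<dots> = eval M \<tau> l" by (simp add: \<tau>_def variant eval_rename eval_tsubst)
    finally show ?thesis .
  qed
  moreover have "eval M \<rho> t' = eval M \<tau> r"
    by (simp add: \<tau>_def variant t' eval_rename eval_tsubst)
  ultimately show "sat M \<phi> \<rho> \<and> transition M R (eval M \<rho> t) (eval M \<rho> t')"
    using s(1) R0 R0_eq unfolding transition_def by blast
qed

text \<open>Keeping the renamed rule apart from \<open>W\<close>, \<open>t\<close> and
  \<open>\<phi>\<close> allows the valuation of the configuration and that of the rule to be merged
  into one unifying valuation. Agreement on \<open>W\<close> leaves the opposite side of a sequent
  unchanged.\<close>

lemma Delta_complete: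
  fixes M :: "('f, 'v::infinite, 's) model"
  assumes "is_umas M umas" and "topmost_lctrs M cfg R" and "finite W"
    and "term_of_sort M cfg t" and "valuation M \<rho>" and "sat M \<phi> \<rho>"
    and "transition M R (eval M \<rho> t) u"
  obtains t' \<phi>' \<rho>' where "(t', \<phi>') \<in> Delta M umas W R (t, \<phi>)" "valuation M \<rho>'"
    "\<And>x. x \<in> W \<Longrightarrow> \<rho>' x = \<rho> x" "sat M \<phi>' \<rho>'" "u = eval M \<rho>' t'"
proof -
  let ?W = "W \<union> vars t \<union> fv \<phi>"
  obtain l r \<phi>lr \<tau> where rule: "(l, r, \<phi>lr) \<in> R" and \<tau>: "valuation M \<tau>" "sat M \<phi>lr \<tau>"
    and step: "eval M \<rho> t = eval M \<tau> l" "u = eval M \<tau> r"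
    using assms(7) by (auto simp: transition_def)
  obtain l' r' \<phi>lr' where apart: "apart ?W (l, r, \<phi>lr) = (l', r', \<phi>lr')" by (metis prod_cases3)
  from apart obtain \<pi> where \<pi>: "bij \<pi>" "\<And>x. snd (\<pi> x) = snd x"
    and variant: "l' = map_trm id \<pi> l" "r' = map_trm id \<pi> r" "\<phi>lr' = map_fm id \<pi> \<phi>lr"
    and disj: "(vars l' \<union> vars r' \<union> fv \<phi>lr') \<inter> ?W = {}"
    by (rule apart_cases[rotated]) (use assms(3) in auto)
  have "wf_rule M cfg (l, r, \<phi>lr)"
    using assms(2) rule by (auto simp: topmost_lctrs_def)
  then have sort_l': "term_of_sort M cfg l'"
    using \<pi>(2) by (auto simp: variant wf_rule_def intro: term_of_sort_rename)
  \<comment> \<open>The merged valuation: \<open>\<rho>\<close> on the variables in play, and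
    elsewhere, in particular on the renamed rule, the rule valuation pulled back through
    \<open>\<pi>\<close>.\<close>
  define \<rho>2 where "\<rho>2 x = (if x \<in> ?W then \<rho> x else \<tau> (inv \<pi> x))" for x
  have "snd (inv \<pi> x) = snd x" for x
    using \<pi> by (metis bij_inv_eq_iff)
  then have val: "valuation M \<rho>2"
    using assms(5) \<tau>(1) unfolding valuation_def \<rho>2_def by metis
  have \<tau>_\<pi>: "\<tau> \<circ> inv \<pi> \<circ> \<pi> = \<tau>"
    using \<pi>(1) by (simp add: bij_is_inj fun_eq_iff)
  have "eval M \<rho>2 l' = eval M (\<tau> \<circ> inv \<pi>) l'"
    by (rule eval_cong) (use disj in \<open>auto simp: \<rho>2_def\<close>)
  then have l': "eval M \<rho>2 l' = eval M \<tau> l" by (simp only: variant eval_rename \<tau>_\<pi>)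
  have "eval M \<rho>2 r' = eval M (\<tau> \<circ> inv \<pi>) r'"
    by (rule eval_cong) (use disj in \<open>auto simp: \<rho>2_def\<close>)
  then have r': "eval M \<rho>2 r' = eval M \<tau> r" by (simp only: variant eval_rename \<tau>_\<pi>)
  have "sat M \<phi>lr' \<rho>2 = sat M \<phi>lr' (\<tau> \<circ> inv \<pi>)"
    by (rule sat_cong) (use disj in \<open>auto simp: \<rho>2_def\<close>)
  then have sat_lr: "sat M \<phi>lr' \<rho>2"
    using \<tau>(2) by (simp only: variant sat_rename[OF bij_is_inj[OF \<pi>(1)] \<pi>(2)] \<tau>_\<pi>)
  have "eval M \<rho>2 t = eval M \<rho> t" by (rule eval_cong) (simp add: \<rho>2_def)
  then have eq: "eval M \<rho>2 t = eval M \<rho>2 l'" using l' step(1) by simp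
  obtain \<phi>u \<sigma> \<rho>' where u: "(\<phi>u, \<sigma>) \<in> umas t l'" and \<rho>2: "\<rho>2 = eval M \<rho>' \<circ> \<sigma>" and "sat M \<phi>u \<rho>'"
    using is_umas_complete[OF assms(1,4) sort_l' val eq] by metis
  note umas = is_umasD[OF assms(1,4) sort_l' u]
  \<comment> \<open>Idempotence at work: evaluating \<open>\<sigma> x\<close> under
    \<open>\<rho>2\<close> means evaluating \<open>\<sigma>\<close> applied to
    \<open>\<sigma> x\<close>, that is \<open>\<sigma> x\<close> itself, under
    \<open>\<rho>'\<close>. Hence \<open>\<rho>2\<close> satisfies the recorded equations.\<close>
  have eval_\<sigma>: "eval M \<rho>2 (\<sigma> x) = \<rho>2 x" for x
    using eval_tsubst[of M \<rho>' \<sigma> "\<sigma> x"] umas(2)[of x] by (simp add: \<rho>2)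
  then have \<rho>2_\<sigma>: "eval M \<rho>2 \<circ> \<sigma> = \<rho>2" by auto
  \<comment> \<open>The unifier fixes the variables of its constraint, so \<open>\<rho>2\<close> and
    \<open>\<rho>'\<close> coincide on them.\<close>
  have "sat M \<phi>u \<rho>2 = sat M \<phi>u \<rho>'"
    by (rule sat_cong) (simp add: \<rho>2 umas(3))
  moreover have "sat M \<phi> \<rho>2 = sat M \<phi> \<rho>"
    by (rule sat_cong) (simp add: \<rho>2_def)
  ultimately have sat: "sat M (deriv_constr (t, \<phi>) \<phi>lr' \<phi>u \<sigma>) \<rho>2"
    using \<open>sat M \<phi>u \<rho>'\<close> assms(6) sat_lr by (simp add: sat_deriv_constr \<rho>2_\<sigma> eval_\<sigma>)
  then have "(tsubst \<sigma> r', deriv_constr (t, \<phi>) \<phi>lr' \<phi>u \<sigma>) \<in> Delta_rule M umas (l', r', \<phi>lr') (t, \<phi>)"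
    using u val by (auto simp: Delta_rule_def satisfiable_def)
  then have "(tsubst \<sigma> r', deriv_constr (t, \<phi>) \<phi>lr' \<phi>u \<sigma>) \<in> Delta M umas W R (t, \<phi>)"
    using rule apart by (force simp: Delta_def)
  moreover have "u = eval M \<rho>2 (tsubst \<sigma> r')"
    by (simp add: eval_tsubst \<rho>2_\<sigma> r' step(2))
  moreover have "\<And>x. x \<in> W \<Longrightarrow> \<rho>2 x = \<rho> x" by (simp add: \<rho>2_def)
  ultimately show ?thesis using that val sat by blast
qed

text \<open>Each derivative's constraint includes the one it was derived from, so a single valuation
  of the last constraint realises the whole chain of steps.\<close>

lemma Delta_between_sound:
  fixes M :: "('f, 'v::infinite, 's) model"
  assumes "wf_setting M" and "is_umas M umas" and "topmost_lctrs M cfg R" and "finite W"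
    and "term_of_sort M cfg Q" and "(Q', \<phi>') \<in> Delta_between M umas W R a k Q"
    and "valuation M \<rho>" and "sat M \<phi>' \<rho>"
  obtains i where "a \<le> i" "(transition M R ^^ i) (eval M \<rho> Q) (eval M \<rho> Q')"
proof -
  let ?D = "\<lambda>S. \<Union>ct \<in> S. Delta M umas W R ct"
  obtain i where i: "a \<le> i" "(Q', \<phi>') \<in> (?D ^^ i) {(Q, Top)}"
    using assms(6) by (auto simp: Delta_between_def)
  have "(Q', \<phi>') \<in> (?D ^^ i) {(Q, Top)} \<Longrightarrow> term_of_sort M cfg Q' \<and>
    (sat M \<phi>' \<rho> \<longrightarrow> (transition M R ^^ i) (eval M \<rho> Q) (eval M \<rho> Q'))"
  proof (induction i arbitrary: Q' \<phi>')
    case 0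
    then show ?case using assms(5) by simp
  next
    case (Suc i)
    then obtain Q1 \<phi>1 where Q1: "(Q1, \<phi>1) \<in> (?D ^^ i) {(Q, Top)}"
      and D: "(Q', \<phi>') \<in> Delta M umas W R (Q1, \<phi>1)"
      by auto
    note IH = Suc.IH[OF Q1]
    show ?case
      using Delta_sound[OF assms(1-4) _ D] IH assms(7) by (auto intro: relcomppI)
  qed
  with i assms(8) that show ?thesis by blast
qed


section \<open>Soundness\<close>

text \<open>The disjunction in \<open>partial_sim\<close> for a fixed final left configuration
  \<open>p\<close> and right start \<open>q\<close>, isolated so that it can be moved along right
  steps.\<close>

definition sim_result ::
  "('f, 'v, 's) model \<Rightarrow> ('f, 'v, 's) rule set \<Rightarrow> (('f, 'v, 's) tm \<times> ('f, 'v, 's) tm) set \<Rightarrow>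
   ('f, 'v, 's) tm \<Rightarrow> ('f, 'v, 's) tm \<Rightarrow> bool" where
  "sim_result M R BB p q \<longleftrightarrow>
    (\<exists>q'. complete_path M R q q' \<and> (p, q') \<in> BB) \<or> infinite_path M R q"

lemma infinite_path_step:
  assumes "transition M R q q'" and "infinite_path M R q'"
  shows "infinite_path M R q"
proof -
  obtain f where f: "f 0 = q'" "\<And>i. transition M R (f i) (f (Suc i))"
    using assms(2) by (auto simp: infinite_path_def)
  have "transition M R (case_nat q f i) (case_nat q f (Suc i))" for i
    using assms(1) f by (cases i) auto
  then show ?thesis unfolding infinite_path_def by (intro exI[of _ "case_nat q f"]) auto
qed

text \<open>Right steps can be prepended to either outcome. Contrapositively, failure at
  \<open>q\<close> passes to everything reachable from \<open>q\<close>.\<close>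

lemma sim_result_steps:
  assumes "(transition M R)\<^sup>*\<^sup>* q q'" and "sim_result M R BB p q'"
  shows "sim_result M R BB p q"
  using assms
proof (induction rule: converse_rtranclp_induct)
  case (step q q1)
  then show ?case unfolding sim_result_def complete_path_def
    by (meson converse_rtranclp_into_rtranclp infinite_path_step)
qed

lemma infinite_pathI:
  assumes "A q" and A: "\<And>q. A q \<Longrightarrow> \<exists>q'. (transition M R)\<^sup>+\<^sup>+ q q' \<and> A q'"
  shows "infinite_path M R q"
proof -
  \<comment> \<open>The given progress may take several transitions at once. Weakening
    \<open>A\<close> to reachability of an \<open>A\<close>-state yields an invariant that a single
    transition can preserve.\<close>
  define A' where "A' q \<longleftrightarrow> (\<exists>q'. (transition M R)\<^sup>*\<^sup>* q q' \<and> A q')" for q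
  have "\<exists>q'. transition M R q q' \<and> A' q'" if "A' q" for q
  proof -
    have "\<exists>q'. (transition M R)\<^sup>+\<^sup>+ q q' \<and> A q'"
      using that A unfolding A'_def by (metis rtranclp_tranclp_tranclp)
    then show ?thesis unfolding A'_def by (metis tranclpD)
  qed
  moreover have "A' q" using assms(1) by (auto simp: A'_def)
  \<comment> \<open>The extra conjunct for index 0 pins the start of the chosen sequence to
    \<open>q\<close>.\<close>
  ultimately obtain f where "f 0 = q" "\<And>i. A' (f i) \<and> transition M R (f i) (f (Suc i))"
    using dependent_nat_choice[of "\<lambda>i x. A' x \<and> (i = 0 \<longrightarrow> x = q)" "\<lambda>_. transition M R"]
    by (metis Zero_not_Suc)
  then show ?thesis unfolding infinite_path_def by blast
qed

lemma denotI:
  "(P, Q, \<phi>) \<in> R \<Longrightarrow> valuation M \<rho> \<Longrightarrow> sat M \<phi> \<rho> \<Longrightarrow> (eval M \<rho> P, eval M \<rho> Q) \<in> denot M R"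
  unfolding denot_def by blast

text \<open>The witness valuation of the side condition agrees with \<open>\<rho>\<close> on
  \<open>P\<close> and \<open>Q\<close>, so its right steps start from the same ground configuration
  and its match concerns the same left one. The bound \<open>a\<close> on derivatives becomes a
  bound on right steps.\<close>

lemma reaches_sub_sound:
  fixes M :: "('f, 'v::infinite, 's) model"
  assumes "wf_setting M" and "is_umas M umas" and "topmost_lctrs M cfgR RR"
    and "term_of_sort M cfgR Q"
    and "reaches_sub M P Q (Delta_between M umas (vars P) RR a k Q) R \<phi>"
    and "valuation M \<rho>" and "sat M \<phi> \<rho>"
  obtains i q where "a \<le> i" "(transition M RR ^^ i) (eval M \<rho> Q) q"
    "(eval M \<rho> P, q) \<in> denot M R"
proof -
  obtain Q' \<phi>' \<rho>' where Q': "(Q', \<phi>') \<in> Delta_between M umas (vars P) RR a k Q"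
    and \<rho>': "valuation M \<rho>'" "\<And>x. x \<in> vars P \<union> vars Q \<Longrightarrow> \<rho>' x = \<rho> x" "sat M \<phi>' \<rho>'"
    and sub: "sat_sub M \<rho>' P Q' R"
    using assms(5-7) unfolding reaches_sub_def by blast
  have "eval M \<rho>' P = eval M \<rho> P" "eval M \<rho>' Q = eval M \<rho> Q"
    using \<rho>'(2) by (auto intro: eval_cong)
  moreover from sub have "(eval M \<rho>' P, eval M \<rho>' Q') \<in> denot M R"
    unfolding sat_sub_def by (auto intro: denotI)
  moreover obtain i where "a \<le> i" "(transition M RR ^^ i) (eval M \<rho>' Q) (eval M \<rho>' Q')"
    by (rule Delta_between_sound[OF assms(1-3) _ assms(4) Q' \<rho>'(1,3)]) auto
  ultimately show ?thesis using that by metis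
qed

text \<open>The second disjunct of the conclusion is a use of Circ before the first left step.\<close>

lemma derivable_sound:
  fixes M :: "('f, 'v::infinite, 's) model"
  assumes "derivable M umas RL RR G B g P Q \<phi>"
    and wf: "wf_setting M" "is_umas M umas" "topmost_lctrs M cfgL RL" "topmost_lctrs M cfgR RR"
    and BB: "base_cases M cfgL cfgR RL RR BB" "denot M B \<subseteq> BB"
    and hyp: "\<And>m p q. m < n \<Longrightarrow> (p, q) \<in> denot M G \<Longrightarrow> (transition M RL ^^ m) p p' \<Longrightarrow>
      sim_result M RR BB p' q"
    and p': "terminal M RL p'"
    and "term_of_sort M cfgL P" "term_of_sort M cfgR Q" "valuation M \<rho>" "sat M \<phi> \<rho>"
    and "(transition M RL ^^ m) (eval M \<rho> P) p'" "if g = 0 then m \<le> n else m < n"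
  shows "sim_result M RR BB p' (eval M \<rho> Q) \<or>
    g = 0 \<and> (\<exists>q. (transition M RR)\<^sup>+\<^sup>+ (eval M \<rho> Q) q \<and> (eval M \<rho> P, q) \<in> denot M G)"
  using assms(1) assms(10-)
proof (induction arbitrary: \<rho> m rule: derivable.induct)
  case (equiv g P Q \<psi> \<phi>)
  then show ?case by (auto simp: equivalent_def)
next
  case (axiom g P Q)
  then show ?case by simp
next
  case (base g P Q \<phi> \<phi>B k)
  show ?case
  proof (cases "sat M \<phi>B \<rho>")
    case False
    then show ?thesis using base.IH base.prems by simp
  next
    case True
    obtain i q where q: "(transition M RR ^^ i) (eval M \<rho> Q) q" "(eval M \<rho> P, q) \<in> denot M B"
      by (rule reaches_sub_sound[OF wf(1,2,4) base.prems(2) base.hyps(3) base.prems(3) True])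
    then have *: "(eval M \<rho> P, q) \<in> BB" "terminal M RL (eval M \<rho> P)" "terminal M RR q"
      using BB by (auto simp: base_cases_def)
    \<comment> \<open>Base cases are terminal on the left, so the left path cannot leave
      \<open>eval M \<rho> P\<close>.\<close>
    then have "m = 0"
      using base.prems(5) by (cases m) (auto simp: terminal_def simp del: relpowp.simps dest: relpowp_Suc_D2)
    then have "p' = eval M \<rho> P" using base.prems(5) by simp
    moreover have "(transition M RR)\<^sup>*\<^sup>* (eval M \<rho> Q) q" using q(1) by (rule relpowp_imp_rtranclp)
    ultimately show ?thesis using * by (auto simp: sim_result_def complete_path_def)
  qed
next
  case (circ g P Q \<phi> \<phi>G k)
  show ?case
  proof (cases "sat M \<phi>G \<rho>")
    case False
    then show ?thesis using circ.IH circ.prems by simp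
  next
    case True
    obtain i q where q: "1 - g \<le> i" "(transition M RR ^^ i) (eval M \<rho> Q) q"
      "(eval M \<rho> P, q) \<in> denot M G"
      by (rule reaches_sub_sound[OF wf(1,2,4) circ.prems(2) circ.hyps(3) circ.prems(3) True])
    show ?thesis
    proof (cases "g = 0")
      case True
      \<comment> \<open>For flag 0 the bound \<open>1 - g\<close> is 1, which makes the number of
        right steps positive.\<close>
      then have "(transition M RR)\<^sup>+\<^sup>+ (eval M \<rho> Q) q"
        using q(1,2) unfolding tranclp_power by (intro exI[of _ i]) simp
      with True q(3) show ?thesis by blast
    next
      case False
      \<comment> \<open>Flag 1 comes with a left path strictly shorter than \<open>n\<close>, so
        \<open>hyp\<close> covers the pair reached in the denotation of \<open>G\<close>.\<close>
      then have "sim_result M RR BB p' q" using hyp q(3) circ.prems by auto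
      then show ?thesis using q(2) relpowp_imp_rtranclp sim_result_steps by metis
    qed
  qed
next
  case (step cts Q P \<phi> g)
  show ?case
  proof (cases m)
    case 0
    \<comment> \<open>On an empty left path the start is already terminal. A satisfied derivative
      would yield a left step, so \<open>\<rho>\<close> falls under the premise for the negated
      derivative constraints.\<close>
    have no_deriv: "\<not> sat M \<phi>' \<rho>" if "(P', \<phi>') \<in> set cts" for P' \<phi>'
    proof
      assume "sat M \<phi>' \<rho>"
      then have "transition M RL (eval M \<rho> P) (eval M \<rho> P')"
        using Delta_sound(2)[OF wf(1-3) _ step.prems(1), of "vars Q" P' \<phi>' \<phi>] that step.hyps(1) step.prems(3)
        by auto
      then show False using p' 0 step.prems(5) by (auto simp: terminal_def)
    qed
    have "sat M (Conj \<phi> (conjs (map (\<lambda>(P', \<phi>'). Neg \<phi>') cts))) \<rho>"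
      using step.prems(4) by (auto dest: no_deriv)
    then show ?thesis using step.IH(2) step.prems by blast
  next
    case (Suc m')
    then obtain p1 where p1: "transition M RL (eval M \<rho> P) p1" "(transition M RL ^^ m') p1 p'"
      using step.prems(5) relpowp_Suc_D2 by metis
    \<comment> \<open>Taking \<open>vars Q\<close> for \<open>W\<close> ensures that the new
      valuation gives \<open>Q\<close> the same value.\<close>
    obtain P' \<phi>' \<rho>' where D: "(P', \<phi>') \<in> Delta M umas (vars Q) RL (P, \<phi>)" and \<rho>': "valuation M \<rho>'"
      "\<And>x. x \<in> vars Q \<Longrightarrow> \<rho>' x = \<rho> x" "sat M \<phi>' \<rho>'" "p1 = eval M \<rho>' P'"
      using Delta_complete[OF wf(2,3) finite_vars[of Q] step.prems(1,3,4) p1(1)] by metis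
    have "term_of_sort M cfgL P'"
      using Delta_sound(1)[OF wf(1-3) finite_vars step.prems(1) D] .
    \<comment> \<open>The premise has flag 1, which rules out the second disjunct; its requirement
      \<open>m' < n\<close> holds because \<open>Suc m' \<le> n\<close> for either value of
      \<open>g\<close>.\<close>
    then have "sim_result M RR BB p' (eval M \<rho>' Q)"
      using step.IH(1)[of P' \<phi>' \<rho>' m'] D step.hyps(1) step.prems(2,6) \<rho>' p1(2) Suc
      by (auto split: if_splits)
    moreover have "eval M \<rho>' Q = eval M \<rho> Q" using \<rho>'(2) by (rule eval_cong)
    ultimately show ?thesis by simp
  qed
qed

theorem theorem3:
  fixes M :: "('f, 'v::infinite, 's) model"
    and umas :: "('f, 'v, 's) umas_fun"
    and cfgL cfgR :: 's
    and RL RR :: "('f, 'v, 's) rule set"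
    and BB :: "(('f, 'v, 's) tm \<times> ('f, 'v, 's) tm) set"
    and B G :: "('f, 'v, 's) psf set"
  assumes "wf_setting M"
    and "is_umas M umas"
    and "topmost_lctrs M cfgL RL" and "coherent M RL"
    and "topmost_lctrs M cfgR RR" and "coherent M RR"
    and "base_cases M cfgL cfgR RL RR BB"
    and "\<forall>F \<in> B. wf_psf M cfgL cfgR F" and "\<forall>F \<in> G. wf_psf M cfgL cfgR F"
    and "derivable_set M umas RL RR G B 0 G"
    and "denot M B \<subseteq> BB"
  shows "\<forall>(P, Q, \<phi>) \<in> G. partial_sim M RL RR BB (P, Q, \<phi>)"
proof -
  have main: "sim_result M RR BB p' q"
    if "(p, q) \<in> denot M G" "(transition M RL ^^ n) p p'" "terminal M RL p'" for n p q p'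
    using that
  proof (induction n arbitrary: p q rule: less_induct)
    case (less n)
    \<comment> \<open>The left configuration \<open>p\<close> and the length \<open>n\<close> stay
      fixed: an early use of Circ advances only the right side, so the induction on \<open>n\<close>
      cannot absorb it.\<close>
    have next_right: "sim_result M RR BB p' q \<or> (\<exists>q'. (transition M RR)\<^sup>+\<^sup>+ q q' \<and> (p, q') \<in> denot M G)"
      if pq: "(p, q) \<in> denot M G" for q
    proof -
      obtain P Q \<phi> \<rho> where F: "(P, Q, \<phi>) \<in> G" "valuation M \<rho>" "sat M \<phi> \<rho>"
        and eq: "p = eval M \<rho> P" "q = eval M \<rho> Q"
        using pq by (auto simp: denot_def)
      have "derivable M umas RL RR G B 0 P Q \<phi>"
        using assms(10) F(1) by (auto simp: derivable_set_def)
      moreover have "term_of_sort M cfgL P" "term_of_sort M cfgR Q"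
        using assms(9) F(1) by (auto simp: wf_psf_def)
      ultimately show ?thesis
        using derivable_sound[OF _ assms(1,2,3,5,7,11), of G 0 P Q \<phi> n p' \<rho> n] less F
        unfolding eq by auto
    qed
    show ?case
    proof (rule ccontr)
      assume no: "\<not> sim_result M RR BB p' q"
      \<comment> \<open>The invariant combines membership in the denotation with failure of the
        simulation. Failure excludes the first alternative of \<open>next_right\<close> and passes
        on to the next right configuration; the resulting infinite path is itself an admissible
        outcome, a contradiction.\<close>
      have "infinite_path M RR q"
      proof (rule infinite_pathI)
        show "(p, q) \<in> denot M G \<and> \<not> sim_result M RR BB p' q"
          using no less.prems(1) by blast
        show "\<exists>q'. (transition M RR)\<^sup>+\<^sup>+ q q' \<and> (p, q') \<in> denot M G \<and> \<not> sim_result M RR BB p' q'"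
          if "(p, q) \<in> denot M G \<and> \<not> sim_result M RR BB p' q" for q
          using that next_right sim_result_steps tranclp_into_rtranclp by metis
      qed
      then show False using no by (simp add: sim_result_def)
    qed
  qed
  show ?thesis
  proof (clarify, unfold partial_sim_def, clarify)
    fix P Q \<phi> \<rho> P'
    assume "(P, Q, \<phi>) \<in> G" "valuation M \<rho>" "sat M \<phi> \<rho>"
      and path: "complete_path M RL (eval M \<rho> P) P'"
      and no_inf: "\<not> infinite_path M RR (eval M \<rho> Q)"
    then have "(eval M \<rho> P, eval M \<rho> Q) \<in> denot M G" by (blast intro: denotI)
    moreover obtain n where "(transition M RL ^^ n) (eval M \<rho> P) P'"
      using path rtranclp_imp_relpowp unfolding complete_path_def by metis
    ultimately have "sim_result M RR BB P' (eval M \<rho> Q)"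
      using main path by (auto simp: complete_path_def)
    then show "\<exists>Q'. complete_path M RR (eval M \<rho> Q) Q' \<and> (P', Q') \<in> BB"
      using no_inf by (auto simp: sim_result_def)
  qed
qed

end
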